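(* Let $n\ge 3$. On the subspace $X^n$ the amplitudes $m$ and $m_{\alpha'}$ simplify as follows (as identities of rational, respectively meromorphic, functions of the independent coordinates $s_{12},s_{23},\ldots,s_{n-2,n-1}$ of $X^n$, where $\alpha'\neq 0$ is a parameter): $$m\big((12\cdots n)\,\vert\,(12\cdots n)\big)\Big\vert_{X^n}=\frac{s_{12\cdots n-1}}{s_{12}s_{23}\cdots s_{n-2,n-1}},$$ $$m_{\alpha'}\big(PT(1,\ldots,n),PT(1,\ldots,n)\big)\Big\vert_{X^n}=\frac{1-\exp\left(-2\pi i\alpha'\sum_{k=1}^{n-2}s_{k,k+1}\right)}{\prod_{k=1}^{n-2}\left(1-e^{-2\pi i\alpha' s_{k,k+1}}\right)}.$$
   Context: $X^n$ is the space of real symmetric $n\times n$ matrices $(s_{ij})$ such that: (1) $s_{ii}=0$ for $i=1,\ldots,n-1$; (2) $s_{ij}=0$ whenever $|i-j|>1$, $1\le i,j\le n-1$; (3) $s_{in}=-\sum_{j=1}^{n-1}s_{ij}$ for $i=1,\ldots,n-1$; (4) $s_{nn}=\sum_{1\le i<j\le n-1}s_{ij}$. Thus $X^n$ has the $n-2$ independent coordinates $s_{12},s_{23},\ldots,s_{n-2,n-1}$. For $1\le p<q\le n-1$ write $s_{p,p+1,\ldots,q}=\sum_{p\le k<l\le q}s_{kl}$; in particular $s_{12\cdots n-1}=\sum_{1\le k<l\le n-1}s_{kl}$. Partial triangulations of the $n$-gon (sets of pairwise non-crossing diagonals) are encoded as follows: a diagonal corresponds to an interval $[p,q]=\{p,p+1,\ldots,q\}$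 with $1\le p<q\le n-1$ and $(p,q)\ne(1,n-1)$, and two diagonals are non-crossing iff the corresponding intervals, as sets of integers, are nested or disjoint. Let $\mathcal{T}_n$ be the set of all sets $T$ of such intervals which are pairwise nested or disjoint (including $T=\emptyset$), and $|T|$ the number of intervals in $T$; the maximal elements of $\mathcal{T}_n$ have $|T|=n-3$. The diagonal biadjoint scalar amplitude is $$m\big((12\cdots n)\,\vert\,(12\cdots n)\big)=\sum_{T\in\mathcal{T}_n,\ |T|=n-3}\ \prod_{[p,q]\in T}\frac{1}{s_{p,p+1,\ldots,q}},$$ and its $\alpha'$-deformation is $$m_{\alpha'}\big(PT(1,\ldots,n),PT(1,\ldots,n)\big)=\sum_{T\in\mathcal{T}_n}(-1)^{(n-3)-|T|}\prod_{[p,q]\in T}\frac{1}{1-e^{-2\pi i\alpha' s_{p,p+1,\ldots,q}}}.$$ Here $i=\sqrt{-1}$ in exponentials, and $PT(1,\ldots,n)$ is merely a label for the cyclic order $(1,2,\ldots,n)$. *)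

theory Defs
  imports Complex_Main
begin

text \<open>
  An $n \times n$ matrix is a function of type \<^typ>\<open>nat \<Rightarrow> nat \<Rightarrow> 'a\<close>, used only at indices in
  $\{1, \dots, n\}$; its values at other indices are unconstrained and irrelevant.
\<close>

definition mandelstam :: "(nat \<Rightarrow> nat \<Rightarrow> 'a::comm_monoid_add) \<Rightarrow> nat \<Rightarrow> nat \<Rightarrow> 'a" where
  "mandelstam s p q = (\<Sum>(k, l)\<in>{(k, l). p \<le> k \<and> k < l \<and> l \<le> q}. s k l)"

text \<open>
  For \<^typ>\<open>'a\<close> the reals this is the real space $X^n$. For \<^typ>\<open>'a\<close> the complex numbers it is
  its complexification, i.e. the independent coordinates $s_{k,k+1}$ take complex values;
  this is where meromorphic functions of those coordinates are evaluated.
\<close>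

definition X :: "nat \<Rightarrow> (nat \<Rightarrow> nat \<Rightarrow> 'a::ab_group_add) set" where
  "X n = {s.
     (\<forall>i\<in>{1..n}. \<forall>j\<in>{1..n}. s i j = s j i) \<and>
     (\<forall>i\<in>{1..n-1}. s i i = 0) \<and>
     (\<forall>i\<in>{1..n-1}. \<forall>j\<in>{1..n-1}. \<bar>int i - int j\<bar> > 1 \<longrightarrow> s i j = 0) \<and>
     (\<forall>i\<in>{1..n-1}. s i n = - (\<Sum>j=1..n-1. s i j)) \<and>
     s n n = mandelstam s 1 (n-1)}"

lemma X_complexify:
  assumes "s \<in> X n"
  shows "(\<lambda>i j. complex_of_real (s i j)) \<in> X n"
  using assms by (simp add: X_def mandelstam_def case_prod_unfold)

text \<open>The pair $(p,q)$ encodes the diagonal given by the interval $[p,q]$.\<close>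

definition diagonals :: "nat \<Rightarrow> (nat \<times> nat) set" where
  "diagonals n = {(p, q). 1 \<le> p \<and> p < q \<and> q \<le> n - 1 \<and> (p, q) \<noteq> (1, n - 1)}"

definition noncrossing :: "nat \<times> nat \<Rightarrow> nat \<times> nat \<Rightarrow> bool" where
  "noncrossing I J \<longleftrightarrow>
     {fst I..snd I} \<subseteq> {fst J..snd J} \<or> {fst J..snd J} \<subseteq> {fst I..snd I} \<or>
     {fst I..snd I} \<inter> {fst J..snd J} = {}"

definition partial_triangulations :: "nat \<Rightarrow> (nat \<times> nat) set set" where
  "partial_triangulations n =
     {T. T \<subseteq> diagonals n \<and> (\<forall>I\<in>T. \<forall>J\<in>T. noncrossing I J)}"

definition m :: "nat \<Rightarrow> (nat \<Rightarrow> nat \<Rightarrow> 'a::field) \<Rightarrow> 'a" where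
  "m n s = (\<Sum>T\<in>{T \<in> partial_triangulations n. card T = n - 3}.
              \<Prod>(p, q)\<in>T. 1 / mandelstam s p q)"

definition phase :: "complex \<Rightarrow> complex \<Rightarrow> complex" where
  "phase \<alpha>' x = exp (- 2 * of_real pi * \<i> * \<alpha>' * x)"

text \<open>
  The truncated subtraction in the exponent below is harmless for $n \ge 3$, as a partial
  triangulation of the $n$-gon has at most $n-3$ diagonals.
\<close>

definition m_deformed :: "complex \<Rightarrow> nat \<Rightarrow> (nat \<Rightarrow> nat \<Rightarrow> complex) \<Rightarrow> complex" where
  "m_deformed \<alpha>' n s = (\<Sum>T\<in>partial_triangulations n.
     (-1) ^ ((n - 3) - card T) * (\<Prod>(p, q)\<in>T. 1 / (1 - phase \<alpha>' (mandelstam s p q))))"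

end

theory Submission imports Defs begin

text \<open>
  On $X^n$ the variable of an interval $[p,q]$ is the sum of the $s_{k,k+1}$ over its edges
  $p \<le> k < q$. Put $a_k = e^{-2\pi i \alpha' s_{k,k+1}}$ and
  $A_{pq} = \prod_{p \<le> k < q} a_k$. A noncrossing family on $[p,q]$ not containing $[p,q]$
  splits uniquely as a family on a block $[p,r]$ with $r < q$, containing $[p,r]$ unless $r = p$,
  and an arbitrary family on $[r+1,q]$. By induction the first factor has weighted sum
  $\prod_{p \<le> k < r} 1/(a_k - 1)$ and the second $\prod_{r < k < q} a_k/(a_k - 1)$, and the
  sum over $r$ telescopes to $(A_{pq} - 1)/\prod_{p \<le> k < q} (a_k - 1)$. This is the identity
  for the deformed amplitude. The undeformed one is its leading coefficient:
  take $a_k = e^{\varepsilon s_{k,k+1}}$, multiply by $\varepsilon^{n-3}$ and let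
  $\varepsilon$ tend to $0$.
\<close>

section \<open>Noncrossing families of intervals\<close>

definition intervals :: "nat \<Rightarrow> nat \<Rightarrow> (nat \<times> nat) set" where
  "intervals p q = {(i, j). p \<le> i \<and> i < j \<and> j \<le> q}"

definition laminar :: "nat \<Rightarrow> nat \<Rightarrow> (nat \<times> nat) set set" where
  "laminar p q = {T. T \<subseteq> intervals p q \<and> (\<forall>I\<in>T. \<forall>J\<in>T. noncrossing I J)}"

text \<open>Excluding the full interval mirrors the exclusion of \<open>(1, n - 1)\<close> from the
  diagonals.\<close>

definition proper_laminar :: "nat \<Rightarrow> nat \<Rightarrow> (nat \<times> nat) set set" where
  "proper_laminar p q = {T \<in> laminar p q. (p, q) \<notin> T}"

text \<open>The guard \<open>p < q\<close> lets a one-point block count as rooted by the empty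
  family, so that the left block of a splitting may be trivial.\<close>

definition rooted_laminar :: "nat \<Rightarrow> nat \<Rightarrow> (nat \<times> nat) set set" where
  "rooted_laminar p q = {T \<in> laminar p q. p < q \<longrightarrow> (p, q) \<in> T}"

lemma finite_intervals [simp]: "finite (intervals p q)"
  by (rule finite_subset[of _ "{..q} \<times> {..q}"]) (auto simp: intervals_def)

lemma finite_laminar [simp]: "finite (laminar p q)"
  by (rule finite_subset[of _ "Pow (intervals p q)"]) (auto simp: laminar_def)

lemma finite_proper_laminar [simp]: "finite (proper_laminar p q)"
  by (simp add: proper_laminar_def)

lemma finite_rooted_laminar [simp]: "finite (rooted_laminar p q)"
  by (simp add: rooted_laminar_def)

lemma laminar_finite: "T \<in> laminar p q \<Longrightarrow> finite T"
  using finite_subset[OF _ finite_intervals] by (auto simp: laminar_def)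

lemma intervals_empty: "q \<le> p \<Longrightarrow> intervals p q = {}"
  by (auto simp: intervals_def)

lemma laminar_trivial: "q \<le> p \<Longrightarrow> laminar p q = {{}}"
  by (auto simp: laminar_def intervals_empty)

lemma rooted_laminar_trivial: "q \<le> p \<Longrightarrow> rooted_laminar p q = {{}}"
  by (auto simp: rooted_laminar_def laminar_trivial)

section \<open>Cutting a proper family into a left block and the rest\<close>

lemma laminar_restrict: "T \<in> laminar p q \<Longrightarrow> T \<inter> intervals i j \<in> laminar i j"
  by (auto simp: laminar_def)

lemma noncrossing_iff:
  assumes "i < j" "k < l"
  shows "noncrossing (i, j) (k, l) \<longleftrightarrow> (k \<le> i \<and> j \<le> l) \<or> (i \<le> k \<and> l \<le> j) \<or> j < k \<or> l < i"
proof -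
  have "{i..j} \<inter> {k..l} = {} \<longleftrightarrow> j < k \<or> l < i"
    using assms by (auto simp: set_eq_iff) (meson le_cases le_less_trans not_le order_refl)
  then show ?thesis
    using assms by (auto simp: noncrossing_def)
qed

text \<open>The cut \<open>r\<close> is the largest right end among the members starting at
  \<open>p\<close>, or \<open>p\<close> itself if there are none. Properness keeps \<open>r\<close>
  below \<open>q\<close>.\<close>

lemma proper_laminar_split:
  assumes "T \<in> proper_laminar p q" "p < q"
  obtains r where "r \<in> {p..<q}" "T \<inter> intervals p r \<in> rooted_laminar p r"
    "T \<inter> intervals (r + 1) q \<in> laminar (r + 1) q"
    "T = (T \<inter> intervals p r) \<union> (T \<inter> intervals (r + 1) q)"
proof -
  have T: "T \<in> laminar p q" "(p, q) \<notin> T"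
    using assms(1) by (auto simp: proper_laminar_def)
  then have sub: "p \<le> i \<and> i < j \<and> j \<le> q" if "(i, j) \<in> T" for i j
    using that by (auto simp: laminar_def intervals_def)
  \<comment> \<open>Inserting \<open>p\<close> makes the maximum exist even when no member starts at
    \<open>p\<close>; the left part is then empty.\<close>
  define R where "R = insert p {j. (p, j) \<in> T}"
  have Rsub: "R \<subseteq> {p..<q}"
  proof
    fix j assume "j \<in> R"
    then show "j \<in> {p..<q}"
      using assms(2) T(2) sub[of p j] by (cases "j = q") (auto simp: R_def)
  qed
  then have fin: "finite R"
    by (rule finite_subset) simp
  define r where "r = Max R"
  have rR: "r \<in> R"
    unfolding r_def using fin by (rule Max_in) (simp add: R_def)
  have max: "j \<le> r" if "(p, j) \<in> T" for j
    unfolding r_def using fin by (rule Max_ge) (simp add: R_def that)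
  have root: "(p, r) \<in> T" if "p < r"
    using rR that by (simp add: R_def)
  \<comment> \<open>A member in neither part straddles the gap between \<open>r\<close> and
    \<open>r + 1\<close>. If it starts at \<open>p\<close> it contradicts the maximality of
    \<open>r\<close>; otherwise it crosses \<open>(p, r)\<close>.\<close>
  have "(i, j) \<in> intervals p r \<union> intervals (r + 1) q" if ij: "(i, j) \<in> T" for i j
  proof (rule ccontr)
    assume "\<not> ?thesis"
    then have cross: "i \<le> r" "r < j"
      using sub[OF ij] by (auto simp: intervals_def)
    have "i \<noteq> p"
      using max[of j] ij cross by auto
    then have "p < i"
      using sub[OF ij] by simp
    then have "p < r"
      using cross by simp
    then have "noncrossing (p, r) (i, j)"
      using root ij T by (auto simp: laminar_def)
    then show False
      using \<open>p < r\<close> \<open>p < i\<close> cross sub[OF ij] by (simp add: noncrossing_iff)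
  qed
  then have "T = (T \<inter> intervals p r) \<union> (T \<inter> intervals (r + 1) q)"
    by auto
  moreover have "T \<inter> intervals p r \<in> rooted_laminar p r"
    using root laminar_restrict[OF T(1)] by (auto simp: rooted_laminar_def intervals_def)
  ultimately show thesis
    using that[of r] rR Rsub laminar_restrict[OF T(1)] by blast
qed

text \<open>Intervals on the two sides of the cut are disjoint as sets, so no crossings arise, and
  none of them reaches from \<open>p\<close> to \<open>q\<close>. Intersecting recovers both parts,
  which makes this the inverse of splitting.\<close>

lemma proper_laminar_join:
  assumes r: "r \<in> {p..<q}" and U: "U \<in> rooted_laminar p r" and V: "V \<in> laminar (r + 1) q"
  shows "U \<union> V \<in> proper_laminar p q" "(U \<union> V) \<inter> intervals p r = U"
    "(U \<union> V) \<inter> intervals (r + 1) q = V" "U \<inter> V = {}"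
proof -
  have subs: "U \<subseteq> intervals p r" "V \<subseteq> intervals (r + 1) q"
    using U V by (auto simp: rooted_laminar_def laminar_def)
  have disj: "intervals p r \<inter> intervals (r + 1) q = {}"
    by (auto simp: intervals_def)
  show "(U \<union> V) \<inter> intervals p r = U" "(U \<union> V) \<inter> intervals (r + 1) q = V" "U \<inter> V = {}"
    using subs disj by blast+
  have "noncrossing I J \<and> noncrossing J I" if "I \<in> U" "J \<in> V" for I J
    using that subs by (cases I; cases J) (force simp: intervals_def noncrossing_def)
  moreover have "U \<union> V \<subseteq> intervals p q"
    using subs r by (force simp: intervals_def)
  ultimately have "U \<union> V \<in> laminar p q"
    using U V by (auto simp: rooted_laminar_def laminar_def)
  moreover have "(p, q) \<notin> U \<union> V"
    using subs r by (auto simp: intervals_def)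
  ultimately show "U \<union> V \<in> proper_laminar p q"
    by (simp add: proper_laminar_def)
qed

text \<open>The root of the longer left block would straddle the shorter cut, whereas no member of
  the other decomposition does.\<close>

lemma rooted_laminar_unique:
  assumes "r \<in> {p..<q}" "U \<in> rooted_laminar p r" "V \<in> laminar (r + 1) q"
    and "r' \<in> {p..<q}" "U' \<in> rooted_laminar p r'" "V' \<in> laminar (r' + 1) q"
    and "U \<union> V = U' \<union> V'"
  shows "r = r'"
proof -
  have less_impossible: False
    if "r < r'" "r \<in> {p..<q}" "U \<in> rooted_laminar p r" "V \<in> laminar (r + 1) q"
      "U' \<in> rooted_laminar p r'" "U \<union> V = U' \<union> V'"
    for r r' U V U' V'
  proof -
    have "(p, r') \<in> U \<union> V"
      using that by (auto simp: rooted_laminar_def)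
    moreover have "U \<union> V \<subseteq> intervals p r \<union> intervals (r + 1) q"
      using that by (auto simp: rooted_laminar_def laminar_def)
    ultimately show False
      using that(1,2) by (auto simp: intervals_def)
  qed
  show ?thesis
    using less_impossible[of r r' U V U' V'] less_impossible[of r' r U' V' U V] assms
    by (cases r r' rule: linorder_cases) auto
qed

text \<open>Strong induction on the length: a proper family splits into parts with at most
  \<open>r - p\<close> and \<open>q - r - 1\<close> members, one short of \<open>q - p\<close> in
  total, and the root adds at most one. The two bounds are proved together since each rests on the
  other.\<close>

lemma card_laminar:
  assumes "T \<in> laminar p q" "p \<le> q"
  shows "card T \<le> q - p" "T \<in> proper_laminar p q \<Longrightarrow> p < q \<Longrightarrow> card T < q - p"
proof -
  have "card T \<le> q - p \<and> (T \<in> proper_laminar p q \<longrightarrow> p < q \<longrightarrow> card T < q - p)"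
    using assms
  proof (induction "q - p" arbitrary: p q T rule: less_induct)
    case less
    have proper: "card U < q - p" if U: "U \<in> proper_laminar p q" "p < q" for U
    proof -
      obtain r where r: "r \<in> {p..<q}" "U \<inter> intervals p r \<in> rooted_laminar p r"
          "U \<inter> intervals (r + 1) q \<in> laminar (r + 1) q"
          "U = (U \<inter> intervals p r) \<union> (U \<inter> intervals (r + 1) q)"
        using proper_laminar_split[OF U] .
      have "card (U \<inter> intervals p r) \<le> r - p"
        using less.hyps[of r p] r(1,2) by (auto simp: rooted_laminar_def)
      moreover have "card (U \<inter> intervals (r + 1) q) \<le> q - (r + 1)"
        using less.hyps[of q "r + 1"] r(1,3) by auto
      moreover have "card U \<le> card (U \<inter> intervals p r) + card (U \<inter> intervals (r + 1) q)"
        using card_Un_le r(4) by metis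
      ultimately show ?thesis
        using r(1) by auto
    qed
    show ?case
    proof (cases "p < q")
      case True
      have "T - {(p, q)} \<in> proper_laminar p q"
        using less.prems by (auto simp: proper_laminar_def laminar_def)
      then have "card (T - {(p, q)}) < q - p"
        using proper True by blast
      moreover have "card T \<le> Suc (card (T - {(p, q)}))"
        using card.insert_remove[OF laminar_finite[OF less.prems(1)], of "(p, q)"]
          card_insert_le[of T "(p, q)"] by simp
      ultimately show ?thesis
        using proper True by auto
    qed (use less.prems laminar_trivial in auto)
  qed
  then show "card T \<le> q - p" "T \<in> proper_laminar p q \<Longrightarrow> p < q \<Longrightarrow> card T < q - p"
    by auto
qed

section \<open>Weighted sums over noncrossing families\<close>

text \<open>Splitting and joining match families with triples \<open>(r, U, V)\<close>, and the
  weight is multiplicative over the disjoint union of \<open>U\<close> and \<open>V\<close>.\<close>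

lemma sum_proper_laminar:
  fixes w :: "nat \<times> nat \<Rightarrow> 'a::comm_semiring_1"
  assumes "p < q"
  shows "(\<Sum>T\<in>proper_laminar p q. prod w T) =
    (\<Sum>r=p..<q. (\<Sum>T\<in>rooted_laminar p r. prod w T) * (\<Sum>T\<in>laminar (r + 1) q. prod w T))"
proof -
  let ?S = "SIGMA r:{p..<q}. rooted_laminar p r \<times> laminar (r + 1) q"
  have "bij_betw (\<lambda>(r, U, V). U \<union> V) ?S (proper_laminar p q)"
    unfolding bij_betw_def
  proof
    show "inj_on (\<lambda>(r, U, V). U \<union> V) ?S"
    proof (rule inj_onI)
      fix x y assume xy: "x \<in> ?S" "y \<in> ?S"
        "(\<lambda>(r, U, V). U \<union> V) x = (\<lambda>(r, U, V). U \<union> V) y"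
      obtain r U V r' U' V' where eqs: "x = (r, U, V)" "y = (r', U', V')"
        by (metis prod_cases3)
      have *: "r \<in> {p..<q}" "U \<in> rooted_laminar p r" "V \<in> laminar (r + 1) q"
        "r' \<in> {p..<q}" "U' \<in> rooted_laminar p r'" "V' \<in> laminar (r' + 1) q" "U \<union> V = U' \<union> V'"
        using xy by (auto simp: eqs)
      have "r = r'"
        by (rule rooted_laminar_unique[OF *])
      then show "x = y"
        using * proper_laminar_join(2,3)[of r p q] unfolding eqs by metis
    qed
    show "(\<lambda>(r, U, V). U \<union> V) ` ?S = proper_laminar p q"
    proof
      show "(\<lambda>(r, U, V). U \<union> V) ` ?S \<subseteq> proper_laminar p q"
        using proper_laminar_join(1) by auto
      show "proper_laminar p q \<subseteq> (\<lambda>(r, U, V). U \<union> V) ` ?S"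
      proof
        fix T assume "T \<in> proper_laminar p q"
        then obtain r where "r \<in> {p..<q}" "T \<inter> intervals p r \<in> rooted_laminar p r"
          "T \<inter> intervals (r + 1) q \<in> laminar (r + 1) q"
          "T = (T \<inter> intervals p r) \<union> (T \<inter> intervals (r + 1) q)"
          using proper_laminar_split assms by blast
        then show "T \<in> (\<lambda>(r, U, V). U \<union> V) ` ?S"
          by (intro image_eqI[of _ _ "(r, T \<inter> intervals p r, T \<inter> intervals (r + 1) q)"]) auto
      qed
    qed
  qed
  then have "(\<Sum>T\<in>proper_laminar p q. prod w T) = (\<Sum>(r, U, V)\<in>?S. prod w (U \<union> V))"
    using sum.reindex_bij_betw[of _ ?S "proper_laminar p q" "prod w"]
    by (simp add: case_prod_unfold)
  also have "\<dots> = (\<Sum>(r, U, V)\<in>?S. prod w U * prod w V)"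
  proof (rule sum.cong, simp, clarify)
    fix r U V assume *: "r \<in> {p..<q}" "U \<in> rooted_laminar p r" "V \<in> laminar (r + 1) q"
    then have "finite U" "finite V"
      by (auto simp: rooted_laminar_def dest: laminar_finite)
    then show "prod w (U \<union> V) = prod w U * prod w V"
      using proper_laminar_join(4)[OF *] by (rule prod.union_disjoint)
  qed
  also have "\<dots> = (\<Sum>r=p..<q. \<Sum>(U, V)\<in>rooted_laminar p r \<times> laminar (r + 1) q. prod w U * prod w V)"
    by (rule sum.Sigma[symmetric]) auto
  also have "\<dots> = (\<Sum>r=p..<q. (\<Sum>T\<in>rooted_laminar p r. prod w T) * (\<Sum>T\<in>laminar (r + 1) q. prod w T))"
    by (simp add: sum_product sum.cartesian_product)
  finally show ?thesis .
qed

text \<open>The interval \<open>(p, q)\<close> contains all others and so crosses none; it can be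
  removed or inserted freely.\<close>

lemma sum_rooted_laminar:
  fixes w :: "nat \<times> nat \<Rightarrow> 'a::comm_semiring_1"
  assumes "p < q"
  shows "(\<Sum>T\<in>rooted_laminar p q. prod w T) = w (p, q) * (\<Sum>T\<in>proper_laminar p q. prod w T)"
proof -
  have nc: "noncrossing (p, q) I \<and> noncrossing I (p, q)" if "I \<in> intervals p q" for I
    using that by (cases I) (auto simp: intervals_def noncrossing_def)
  have ins: "insert (p, q) T \<in> rooted_laminar p q" if "T \<in> proper_laminar p q" for T
    using that assms nc
    by (auto simp: rooted_laminar_def proper_laminar_def laminar_def intervals_def noncrossing_def)
  have "(\<Sum>T\<in>rooted_laminar p q. prod w T) = (\<Sum>T\<in>proper_laminar p q. prod w (insert (p, q) T))"
    by (rule sum.reindex_bij_witness[of _ "insert (p, q)" "\<lambda>T. T - {(p, q)}"])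
      (use assms ins in \<open>auto simp: rooted_laminar_def proper_laminar_def laminar_def insert_absorb\<close>)
  also have "\<dots> = (\<Sum>T\<in>proper_laminar p q. w (p, q) * prod w T)"
    by (rule sum.cong) (auto simp: proper_laminar_def laminar_finite)
  finally show ?thesis
    by (simp add: sum_distrib_left)
qed

lemma sum_laminar:
  fixes w :: "nat \<times> nat \<Rightarrow> 'a::comm_semiring_1"
  assumes "p < q"
  shows "(\<Sum>T\<in>laminar p q. prod w T) = (w (p, q) + 1) * (\<Sum>T\<in>proper_laminar p q. prod w T)"
proof -
  have "laminar p q = rooted_laminar p q \<union> proper_laminar p q"
    "rooted_laminar p q \<inter> proper_laminar p q = {}"
    using assms by (auto simp: rooted_laminar_def proper_laminar_def)
  then have "(\<Sum>T\<in>laminar p q. prod w T) =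
      (\<Sum>T\<in>rooted_laminar p q. prod w T) + (\<Sum>T\<in>proper_laminar p q. prod w T)"
    by (simp add: sum.union_disjoint)
  then show ?thesis
    using assms by (simp add: sum_rooted_laminar distrib_right)
qed

text \<open>Over the common denominator the summand has numerator \<open>(a r - 1)\<close> times the
  product of the later \<open>a k\<close>, a difference of consecutive tail products. The proof is
  an induction on \<open>q\<close>: the old terms gain the factor \<open>a q / (a q - 1)\<close> and
  the new term \<open>r = q\<close> is \<open>1 / ?B\<close>.\<close>

lemma telescoping_split_sum:
  fixes a :: "nat \<Rightarrow> 'a::field"
  assumes "p \<le> q" "\<forall>k\<in>{p..<q}. a k \<noteq> 1"
  shows "(\<Sum>r=p..<q. (\<Prod>k=p..<r. 1 / (a k - 1)) * (\<Prod>k=r+1..<q. a k / (a k - 1))) =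
    ((\<Prod>k=p..<q. a k) - 1) / (\<Prod>k=p..<q. (a k - 1))"
  using assms
proof (induction q rule: dec_induct)
  case base
  then show ?case by simp
next
  case (step q)
  let ?B = "\<Prod>k=p..<q. (a k - 1)"
  have nz: "?B \<noteq> 0" "a q - 1 \<noteq> 0"
    using step.hyps step.prems by auto
  have "(\<Sum>r=p..<Suc q. (\<Prod>k=p..<r. 1 / (a k - 1)) * (\<Prod>k=r+1..<Suc q. a k / (a k - 1))) =
      (\<Sum>r=p..<q. (\<Prod>k=p..<r. 1 / (a k - 1)) * (\<Prod>k=r+1..<q. a k / (a k - 1))) *
        (a q / (a q - 1)) + 1 / ?B"
    using step.hyps by (simp add: sum_distrib_right sum_divide_distrib mult.assoc prod_dividef)
  also have "\<dots> = ((\<Prod>k=p..<q. a k) - 1) / ?B * (a q / (a q - 1)) + 1 / ?B"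
    using step.IH step.prems by simp
  also have "\<dots> = ((\<Prod>k=p..<q. a k) * a q - 1) / (?B * (a q - 1))"
    using nz by (simp add: divide_simps) (simp add: algebra_simps)
  finally show ?case
    using step.hyps by simp
qed

text \<open>The weight of \<open>(p, q)\<close> never occurs in a proper family, so
  \<open>A p q = 1\<close> is allowed. When \<open>q = p + 1\<close> the only edge is that excluded
  pair, hence the separate hypothesis on edges.\<close>

lemma sum_proper_laminar_closed_form:
  fixes a :: "nat \<Rightarrow> 'a::field"
  defines "A \<equiv> \<lambda>p q. \<Prod>k=p..<q. a k"
  assumes "p < q"
    and "\<forall>(i, j)\<in>intervals p q - {(p, q)}. A i j \<noteq> 1"
    and "\<forall>k\<in>{p..<q}. a k \<noteq> 1"
  shows "(\<Sum>T\<in>proper_laminar p q. \<Prod>(i, j)\<in>T. 1 / (A i j - 1)) =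
    (A p q - 1) / (\<Prod>k=p..<q. (a k - 1))"
  using assms(2-)
proof (induction "q - p" arbitrary: p q rule: less_induct)
  case less
  let ?w = "\<lambda>(i, j). 1 / (A i j - 1)"
  have sub: "(\<Sum>T\<in>proper_laminar i j. prod ?w T) = (A i j - 1) / (\<Prod>k=i..<j. (a k - 1))
      \<and> A i j \<noteq> 1"
    if "(i, j) \<in> intervals p q" "(i, j) \<noteq> (p, q)" for i j
  proof -
    have "i < j" "j - i < q - p"
      using that by (auto simp: intervals_def)
    moreover have "intervals i j \<subseteq> intervals p q - {(p, q)}"
      using that by (auto simp: intervals_def)
    moreover have "{i..<j} \<subseteq> {p..<q}"
      using that by (auto simp: intervals_def)
    ultimately have "(\<Sum>T\<in>proper_laminar i j. prod ?w T) = (A i j - 1) / (\<Prod>k=i..<j. (a k - 1))"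
      using less.prems(2,3) by (intro less.hyps) blast+
    then show ?thesis
      using less.prems(2) that by auto
  qed
  \<comment> \<open>The root weight cancels the numerator \<open>A p r - 1\<close>, leaving a
    product over edges; for \<open>r = p\<close> both sides are 1.\<close>
  have rooted: "(\<Sum>T\<in>rooted_laminar p r. prod ?w T) = (\<Prod>k=p..<r. 1 / (a k - 1))"
    if "r \<in> {p..<q}" for r
  proof (cases "p < r")
    case True
    then have "(\<Sum>T\<in>proper_laminar p r. prod ?w T) = (A p r - 1) / (\<Prod>k=p..<r. (a k - 1))
        \<and> A p r \<noteq> 1"
      using that by (intro sub) (auto simp: intervals_def)
    then show ?thesis
      using True by (simp add: sum_rooted_laminar prod_dividef)
  qed (use that in \<open>simp add: rooted_laminar_trivial\<close>)
  \<comment> \<open>Allowing the root or not gives the factor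
    \<open>1 / (A - 1) + 1 = A / (A - 1)\<close>, which replaces the numerator \<open>A - 1\<close>
    by the product \<open>A\<close>.\<close>
  have full: "(\<Sum>T\<in>laminar (r + 1) q. prod ?w T) = (\<Prod>k=r+1..<q. a k / (a k - 1))"
    if "r \<in> {p..<q}" for r
  proof (cases "r + 1 < q")
    case True
    then have *: "(\<Sum>T\<in>proper_laminar (r + 1) q. prod ?w T) =
        (A (r + 1) q - 1) / (\<Prod>k=r+1..<q. (a k - 1)) \<and> A (r + 1) q \<noteq> 1"
      using that by (intro sub) (auto simp: intervals_def)
    have "(\<Sum>T\<in>laminar (r + 1) q. prod ?w T) =
        (1 / (A (r + 1) q - 1) + 1) * ((A (r + 1) q - 1) / (\<Prod>k=r+1..<q. (a k - 1)))"
      using True * by (simp add: sum_laminar)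
    also have "\<dots> = A (r + 1) q / (\<Prod>k=r+1..<q. (a k - 1))"
    proof -
      have "1 / (A (r + 1) q - 1) + 1 = A (r + 1) q / (A (r + 1) q - 1)"
        using * by (subst divide_add_eq_iff) auto
      then show ?thesis
        using * by simp
    qed
    finally show ?thesis
      by (simp add: A_def prod_dividef)
  qed (use that in \<open>simp add: laminar_trivial\<close>)
  have "(\<Sum>T\<in>proper_laminar p q. prod ?w T) =
      (\<Sum>r=p..<q. (\<Prod>k=p..<r. 1 / (a k - 1)) * (\<Prod>k=r+1..<q. a k / (a k - 1)))"
    unfolding sum_proper_laminar[OF less.prems(1)]
    by (rule sum.cong) (simp_all only: rooted full)
  then show ?case
    using telescoping_split_sum[of p q a] less.prems by (simp add: A_def)
qed

section \<open>The amplitudes on the subspace\<close>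

lemma partial_triangulations_eq: "partial_triangulations n = proper_laminar 1 (n - 1)"
  by (auto simp: partial_triangulations_def proper_laminar_def laminar_def diagonals_def
      intervals_def)

lemma diagonals_eq: "diagonals n = intervals 1 (n - 1) - {(1, n - 1)}"
  by (auto simp: diagonals_def intervals_def)

text \<open>This makes the exponent \<open>n - 3 - card T\<close> a true difference, so that it can
  be completed to \<open>n - 3\<close>.\<close>

lemma card_partial_triangulation:
  assumes "T \<in> partial_triangulations n" "n \<ge> 3"
  shows "card T \<le> n - 3"
proof -
  have "T \<in> laminar 1 (n - 1)" "T \<in> proper_laminar 1 (n - 1)"
    using assms(1) by (auto simp: partial_triangulations_eq proper_laminar_def)
  then have "card T < n - 1 - 1"
    using card_laminar(2)[of T 1 "n - 1"] assms(2) by simp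
  then show ?thesis
    by simp
qed

text \<open>Pairs that are not neighbours vanish on \<open>X n\<close>. The bound on
  \<open>q\<close> keeps the sum away from the last column, where this sparsity is not
  imposed.\<close>

lemma mandelstam_X:
  fixes s :: "nat \<Rightarrow> nat \<Rightarrow> 'a::ab_group_add"
  assumes "s \<in> X n" "1 \<le> p" "q \<le> n - 1"
  shows "mandelstam s p q = (\<Sum>k=p..<q. s k (k + 1))"
proof -
  have "mandelstam s p q = (\<Sum>(k, l)\<in>intervals p q. s k l)"
    by (simp add: mandelstam_def intervals_def)
  also have "\<dots> = (\<Sum>(k, l)\<in>(\<lambda>k. (k, k + 1)) ` {p..<q}. s k l)"
  proof (rule sum.mono_neutral_right[OF finite_intervals])
    show "\<forall>I\<in>intervals p q - (\<lambda>k. (k, k + 1)) ` {p..<q}. (case I of (k, l) \<Rightarrow> s k l) = 0"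
    proof clarify
      fix k l assume *: "(k, l) \<in> intervals p q" "(k, l) \<notin> (\<lambda>k. (k, k + 1)) ` {p..<q}"
      have "l \<noteq> k + 1"
      proof
        assume "l = k + 1"
        with * show False by (auto simp: intervals_def)
      qed
      with * have "\<bar>int k - int l\<bar> > 1" "k \<in> {1..n-1}" "l \<in> {1..n-1}"
        using assms(2,3) by (auto simp: intervals_def)
      then show "s k l = 0"
        using assms(1) unfolding X_def by blast
    qed
  qed (auto simp: intervals_def)
  also have "\<dots> = (\<Sum>k=p..<q. s k (k + 1))"
    by (subst sum.reindex) (auto simp: inj_on_def)
  finally show ?thesis .
qed

section \<open>The deformed amplitude\<close>

lemma edge_range: "n \<ge> 3 \<Longrightarrow> {1..n - 2} = {1..<n - 1}" for n :: nat
  by auto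

lemma m_deformed_X:
  assumes n: "n \<ge> 3" and s: "s \<in> X n"
    and nz: "\<forall>(p, q)\<in>diagonals n. 1 - phase \<alpha>' (mandelstam s p q) \<noteq> 0"
    and nz_edges: "\<forall>k\<in>{1..n-2}. 1 - phase \<alpha>' (s k (k+1)) \<noteq> 0"
  shows "m_deformed \<alpha>' n s =
    (1 - phase \<alpha>' (\<Sum>k=1..n-2. s k (k+1))) / (\<Prod>k=1..n-2. (1 - phase \<alpha>' (s k (k+1))))"
proof -
  define a where "a k = phase \<alpha>' (s k (k + 1))" for k
  define A where "A p q = (\<Prod>k=p..<q. a k)" for p q
  have phase_sum: "phase \<alpha>' (\<Sum>k=p..<q. s k (k + 1)) = A p q" for p q
    by (simp add: A_def a_def phase_def sum_distrib_left exp_sum)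
  have phase_diag: "phase \<alpha>' (mandelstam s p q) = A p q" if "(p, q) \<in> diagonals n" for p q
    using that s phase_sum[of p q] by (simp add: mandelstam_X diagonals_def)
  \<comment> \<open>Each factor \<open>1 / (1 - x)\<close> is minus \<open>1 / (x - 1)\<close>. The
    resulting \<open>card T\<close> signs complete the exponent to \<open>n - 3\<close>, the same
    for every family.\<close>
  have "m_deformed \<alpha>' n s =
      (\<Sum>T\<in>partial_triangulations n. (-1) ^ (n - 3) * (\<Prod>(p, q)\<in>T. 1 / (A p q - 1)))"
    unfolding m_deformed_def
  proof (rule sum.cong[OF refl])
    fix T assume T: "T \<in> partial_triangulations n"
    have "(\<Prod>(p, q)\<in>T. 1 / (1 - phase \<alpha>' (mandelstam s p q))) =
        (\<Prod>(p, q)\<in>T. (-1) * (1 / (A p q - 1)))"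
    proof (rule prod.cong[OF refl], clarify)
      fix p q assume "(p, q) \<in> T"
      then have "(p, q) \<in> diagonals n"
        using T by (auto simp: partial_triangulations_def)
      then show "1 / (1 - phase \<alpha>' (mandelstam s p q)) = (-1) * (1 / (A p q - 1))"
        using minus_divide_right[of 1 "A p q - 1"] by (simp add: phase_diag)
    qed
    also have "\<dots> = (-1) ^ card T * (\<Prod>(p, q)\<in>T. 1 / (A p q - 1))"
      by (simp only: case_prod_unfold prod.distrib prod_constant)
    finally have prod_eq: "(\<Prod>(p, q)\<in>T. 1 / (1 - phase \<alpha>' (mandelstam s p q))) =
        (-1) ^ card T * (\<Prod>(p, q)\<in>T. 1 / (A p q - 1))" .
    have "(-1) ^ (n - 3 - card T) * (-1) ^ card T = ((-1) ^ (n - 3) :: complex)"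
      using card_partial_triangulation[OF T n] by (simp only: power_add[symmetric] le_add_diff_inverse2)
    then show "(-1) ^ (n - 3 - card T) * (\<Prod>(p, q)\<in>T. 1 / (1 - phase \<alpha>' (mandelstam s p q))) =
        (-1) ^ (n - 3) * (\<Prod>(p, q)\<in>T. 1 / (A p q - 1))"
      unfolding prod_eq by (simp only: mult.assoc[symmetric])
  qed
  also have "\<dots> = (-1) ^ (n - 3) * ((A 1 (n - 1) - 1) / (\<Prod>k=1..<n-1. (a k - 1)))"
    unfolding sum_distrib_left[symmetric] partial_triangulations_eq A_def
  proof (subst sum_proper_laminar_closed_form)
    show "\<forall>(i, j)\<in>intervals 1 (n - 1) - {(1, n - 1)}. (\<Prod>k=i..<j. a k) \<noteq> 1"
      unfolding diagonals_eq[symmetric]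
      using nz phase_diag by (auto simp: A_def)
    show "\<forall>k\<in>{1..<n - 1}. a k \<noteq> 1"
      using nz_edges n by (auto simp: a_def)
  qed (use n in auto)
  also have "(\<Prod>k=1..<n-1. (a k - 1)) = (\<Prod>k=1..<n-1. (-1) * (1 - a k))"
    by simp
  also have "\<dots> = (-1) ^ (n - 2) * (\<Prod>k=1..<n-1. (1 - a k))"
    unfolding prod.distrib by (simp add: numeral_eq_Suc)
  \<comment> \<open>There is one more edge than there are diagonals in a maximal family, so a single
    sign survives and turns \<open>A 1 (n - 1) - 1\<close> into
    \<open>1 - A 1 (n - 1)\<close>.\<close>
  also have "(-1) ^ (n - 2) = - ((-1) ^ (n - 3) :: complex)"
  proof -
    have "n - 2 = Suc (n - 3)"
      using n by simp
    then show ?thesis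
      by simp
  qed
  also have "(-1) ^ (n - 3) * ((A 1 (n - 1) - 1) / (- ((-1) ^ (n - 3)) * (\<Prod>k=1..<n-1. (1 - a k)))) =
      (1 - A 1 (n - 1)) / (\<Prod>k=1..<n-1. (1 - a k))"
    by (simp add: minus_divide_left)
  finally show ?thesis
    unfolding edge_range[OF n] phase_sum by (simp only: a_def)
qed

section \<open>The undeformed amplitude as a limit\<close>

lemma exp_quotient_tendsto:
  "((\<lambda>\<epsilon>. (exp (\<epsilon> * x) - 1) / \<epsilon>) \<longlongrightarrow> x) (at_right 0)" for x :: real
proof -
  have "((\<lambda>\<epsilon>. exp (\<epsilon> * x)) has_real_derivative x) (at 0)"
    by (auto intro!: derivative_eq_intros)
  then have "((\<lambda>\<epsilon>. (exp (\<epsilon> * x) - 1) / \<epsilon>) \<longlongrightarrow> x) (at 0)"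
    by (simp add: has_field_derivative_iff)
  then show ?thesis
    by (rule tendsto_within_subset) simp
qed

text \<open>The closed form needs interval variables that are multiplicative in the edges, while
  \<open>mandelstam\<close> is additive on \<open>X n\<close>. The quotient \<open>?E\<close> passes
  from the former to the latter as \<epsilon> tends to 0.\<close>

lemma m_X:
  fixes s :: "nat \<Rightarrow> nat \<Rightarrow> real"
  assumes n: "n \<ge> 3" and s: "s \<in> X n"
    and nz: "\<forall>(p, q)\<in>diagonals n. mandelstam s p q \<noteq> 0"
    and nz_edges: "\<forall>k\<in>{1..n-2}. s k (k+1) \<noteq> 0"
  shows "m n s = mandelstam s 1 (n-1) / (\<Prod>k=1..n-2. s k (k+1))"
proof -
  let ?E = "\<lambda>\<epsilon> x. (exp (\<epsilon> * x) - 1) / \<epsilon>"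
  \<comment> \<open>The power of \<epsilon> makes up for the missing diagonals: together with one
    \<epsilon> per member, every family carries \<open>\<epsilon> ^ (n - 3)\<close>.\<close>
  let ?L = "\<lambda>\<epsilon>. \<Sum>T\<in>partial_triangulations n.
    \<epsilon> ^ (n - 3 - card T) * (\<Prod>(p, q)\<in>T. 1 / ?E \<epsilon> (mandelstam s p q))"
  let ?R = "\<lambda>\<epsilon>. ?E \<epsilon> (mandelstam s 1 (n-1)) / (\<Prod>k=1..n-2. ?E \<epsilon> (s k (k+1)))"
  \<comment> \<open>For real nonzero \<open>x\<close> and positive \<epsilon> the value
    \<open>exp (\<epsilon> * x)\<close> differs from 1, so the nonvanishing hypotheses carry over to
    the exponentials.\<close>
  have eq: "?L \<epsilon> = ?R \<epsilon>" if \<epsilon>: "\<epsilon> > 0" for \<epsilon>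
  proof -
    define a where "a k = exp (\<epsilon> * s k (k + 1))" for k
    define A where "A p q = (\<Prod>k=p..<q. a k)" for p q
    have A: "A p q = exp (\<epsilon> * mandelstam s p q)" if "1 \<le> p" "q \<le> n - 1" for p q
      by (simp add: A_def a_def mandelstam_X[OF s that] sum_distrib_left exp_sum)
    have A_diag: "A p q = exp (\<epsilon> * mandelstam s p q)" if "(p, q) \<in> diagonals n" for p q
      using that by (intro A) (auto simp: diagonals_def)
    have "?L \<epsilon> = (\<Sum>T\<in>partial_triangulations n. \<epsilon> ^ (n - 3) * (\<Prod>(p, q)\<in>T. 1 / (A p q - 1)))"
    proof (rule sum.cong[OF refl])
      fix T assume T: "T \<in> partial_triangulations n"
      have "(\<Prod>(p, q)\<in>T. 1 / ?E \<epsilon> (mandelstam s p q)) = (\<Prod>(p, q)\<in>T. \<epsilon> * (1 / (A p q - 1)))"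
        by (rule prod.cong) (use T A_diag in \<open>auto simp: partial_triangulations_def\<close>)
      also have "\<dots> = \<epsilon> ^ card T * (\<Prod>(p, q)\<in>T. 1 / (A p q - 1))"
        by (simp only: case_prod_unfold prod.distrib prod_constant)
      finally have prod_eq: "(\<Prod>(p, q)\<in>T. 1 / ?E \<epsilon> (mandelstam s p q)) =
          \<epsilon> ^ card T * (\<Prod>(p, q)\<in>T. 1 / (A p q - 1))" .
      have "\<epsilon> ^ (n - 3 - card T) * \<epsilon> ^ card T = \<epsilon> ^ (n - 3)"
        using card_partial_triangulation[OF T n] by (simp only: power_add[symmetric] le_add_diff_inverse2)
      then show "\<epsilon> ^ (n - 3 - card T) * (\<Prod>(p, q)\<in>T. 1 / ?E \<epsilon> (mandelstam s p q)) =
          \<epsilon> ^ (n - 3) * (\<Prod>(p, q)\<in>T. 1 / (A p q - 1))"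
        unfolding prod_eq by (simp only: mult.assoc[symmetric])
    qed
    also have "\<dots> = \<epsilon> ^ (n - 3) * ((A 1 (n - 1) - 1) / (\<Prod>k=1..<n-1. (a k - 1)))"
      unfolding sum_distrib_left[symmetric] partial_triangulations_eq A_def
    proof (subst sum_proper_laminar_closed_form)
      show "\<forall>(i, j)\<in>intervals 1 (n - 1) - {(1, n - 1)}. (\<Prod>k=i..<j. a k) \<noteq> 1"
        unfolding diagonals_eq[symmetric]
        using nz A_diag \<epsilon> by (auto simp: A_def)
      show "\<forall>k\<in>{1..<n - 1}. a k \<noteq> 1"
        using nz_edges n \<epsilon> by (auto simp: a_def)
    qed (use n in auto)
    \<comment> \<open>Here \<open>\<epsilon> ^ (n - 3)\<close> is written as
      \<open>\<epsilon> ^ (n - 2) / \<epsilon>\<close>: one \<epsilon> for each of the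
      \<open>n - 2\<close> edges and one for the numerator.\<close>
    also have "\<dots> = ((A 1 (n - 1) - 1) / \<epsilon>) / ((\<Prod>k=1..<n-1. (a k - 1)) / \<epsilon> ^ (n - 2))"
    proof -
      have "n - 2 = Suc (n - 3)"
        using n by simp
      then show ?thesis
        using \<epsilon> by simp
    qed
    also have "(\<Prod>k=1..<n-1. (a k - 1)) / \<epsilon> ^ (n - 2) = (\<Prod>k=1..<n-1. (a k - 1) / \<epsilon>)"
      by (simp add: prod_dividef numeral_eq_Suc)
    finally show ?thesis
      using A[of 1 "n - 1"] unfolding edge_range[OF n] by (simp add: a_def)
  qed
  have "(?L \<longlongrightarrow> (\<Sum>T\<in>partial_triangulations n.
      0 ^ (n - 3 - card T) * (\<Prod>(p, q)\<in>T. 1 / mandelstam s p q))) (at_right 0)"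
    unfolding case_prod_unfold
  proof (intro tendsto_sum tendsto_mult tendsto_power tendsto_prod tendsto_divide tendsto_const
      exp_quotient_tendsto tendsto_ident_at)
    fix T I assume "T \<in> partial_triangulations n" "I \<in> T"
    then show "mandelstam s (fst I) (snd I) \<noteq> 0"
      using nz by (cases I) (auto simp: partial_triangulations_def)
  qed
  \<comment> \<open>Since \<open>0 ^ 0 = 1\<close>, exactly the families with \<open>n - 3\<close>
    diagonals survive; all others have a positive exponent.\<close>
  also have "(\<Sum>T\<in>partial_triangulations n.
      0 ^ (n - 3 - card T) * (\<Prod>(p, q)\<in>T. 1 / mandelstam s p q)) = m n s"
    unfolding m_def
  proof (rule sum.mono_neutral_cong_right)
    show "\<forall>T\<in>partial_triangulations n - {T \<in> partial_triangulations n. card T = n - 3}.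
        0 ^ (n - 3 - card T) * (\<Prod>(p, q)\<in>T. 1 / mandelstam s p q) = 0"
    proof
      fix T assume "T \<in> partial_triangulations n - {T \<in> partial_triangulations n. card T = n - 3}"
      then have "n - 3 - card T > 0"
        using card_partial_triangulation[OF _ n, of T] by auto
      then show "0 ^ (n - 3 - card T) * (\<Prod>(p, q)\<in>T. 1 / mandelstam s p q) = 0"
        by simp
    qed
  qed (auto simp: partial_triangulations_eq)
  finally have L: "(?L \<longlongrightarrow> m n s) (at_right 0)" .
  have "(?R \<longlongrightarrow> mandelstam s 1 (n-1) / (\<Prod>k=1..n-2. s k (k+1))) (at_right 0)"
    by (intro tendsto_divide tendsto_prod exp_quotient_tendsto) (use nz_edges in auto)
  moreover have "eventually (\<lambda>\<epsilon>. ?R \<epsilon> = ?L \<epsilon>) (at_right 0)"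
    using eventually_at_right_less by (rule eventually_mono) (simp only: eq)
  ultimately have "(?L \<longlongrightarrow> mandelstam s 1 (n-1) / (\<Prod>k=1..n-2. s k (k+1))) (at_right 0)"
    by (rule Lim_transform_eventually)
  with L show ?thesis
    by (rule tendsto_unique[rotated]) simp
qed

text \<open>The identities of rational and meromorphic functions are expressed pointwise, where no
  denominator vanishes. For \<open>n = 3\<close> the single edge is the excluded pair
  \<open>(1, n - 1)\<close>, so edges get a condition of their own.\<close>

theorem theorem24:
  fixes n :: nat and \<alpha>' :: complex
  assumes "n \<ge> 3" and "\<alpha>' \<noteq> 0"
  shows
    "(\<forall>s :: nat \<Rightarrow> nat \<Rightarrow> real. s \<in> X n \<longrightarrow>
        (\<forall>(p, q)\<in>diagonals n. mandelstam s p q \<noteq> 0) \<longrightarrow>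
        (\<forall>k\<in>{1..n-2}. s k (k+1) \<noteq> 0) \<longrightarrow>
        m n s = mandelstam s 1 (n-1) / (\<Prod>k=1..n-2. s k (k+1))) \<and>
     (\<forall>s :: nat \<Rightarrow> nat \<Rightarrow> complex. s \<in> X n \<longrightarrow>
        (\<forall>(p, q)\<in>diagonals n. 1 - phase \<alpha>' (mandelstam s p q) \<noteq> 0) \<longrightarrow>
        (\<forall>k\<in>{1..n-2}. 1 - phase \<alpha>' (s k (k+1)) \<noteq> 0) \<longrightarrow>
        m_deformed \<alpha>' n s =
          (1 - phase \<alpha>' (\<Sum>k=1..n-2. s k (k+1))) /
          (\<Prod>k=1..n-2. (1 - phase \<alpha>' (s k (k+1)))))"
  using m_X m_deformed_X assms(1) by blast

end
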